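(* Let $\mathcal{G}$ be a graph, let $\gamma$ be the size of a maximal coclique $\Gamma$ in $\mathcal{G}$ (so $\gamma$ is the coclique number of $\mathcal{G}$), and let $(f,V)$ be a symplectic root system over $\mathbb{F}_2$ on $\mathcal{G}$ of type $(n,k)$. Then $$n\leq|\mathcal{G}-\Gamma|=|\mathcal{G}|-\gamma.$$
   Context: Graphs are finite, undirected, without loops or multiple edges; vector spaces are finite-dimensional; $|\mathcal{G}|$ is the number of nodes. A coclique is a set of pairwise non-adjacent nodes. A symplectic vector space over a field $\Bbbk$ is a $\Bbbk$-vector space $V$ with a (possibly degenerate) bilinear form $\langle,\rangle:V\times V\to\Bbbk$ such that $\langle v,v\rangle=0$ for all $v\in V$. Its nullspace is $V^\perp=\{v\in V\mid \langle v,w\rangle=0\ \forall w\in V\}$, and $V$ has type $(n,k)$ if $k=\dim V^\perp$ and $2n+k=\dim V$. A symplectic root system $(f,V)$ over $\mathbb{F}_2$ on a graph $\mathcal{G}$ consists of a symplectic vector space $V$ over $\mathbb{F}_2$ and a map $f$ from the nodes of $\mathcal{G}$ to $V$ such that the image $f(\mathcal{G})$ generates $V$, and two nodes $\alpha,\beta$ are adjacent in $\mathcal{G}$ if and only if $\langle f(\alpha),f(\beta)\rangle\neq 0$. Its type is the type of $V$. *)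

theory Defs
  imports "HOL-Library.Z2" "Graph_Theory.Pair_Digraph"
begin

text \<open>
  A finite simple graph is a \<^term>\<open>pair_graph G\<close>: a finite loopless symmetric set
  \<^term>\<open>parcs G\<close> of ordered pairs of nodes, so that \<open>(\<alpha>, \<beta>) \<in> parcs G\<close> is adjacency.
\<close>

definition coclique :: "'a pair_pre_digraph \<Rightarrow> 'a set \<Rightarrow> bool" where
  "coclique G C \<longleftrightarrow> C \<subseteq> pverts G \<and> (\<forall>\<alpha>\<in>C. \<forall>\<beta>\<in>C. (\<alpha>, \<beta>) \<notin> parcs G)"

definition coclique_number :: "'a pair_pre_digraph \<Rightarrow> nat" where
  "coclique_number G = Max (card ` {C. coclique G C})"

text \<open>
  The vector space \<open>V\<close> is the whole type \<open>'v\<close> with scalar multiplication \<open>scale\<close>.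
  The form is not assumed to be nondegenerate.
\<close>

locale symplectic_vector_space = vector_space scale
  for scale :: "'k::field \<Rightarrow> 'v::ab_group_add \<Rightarrow> 'v" +
  fixes form :: "'v \<Rightarrow> 'v \<Rightarrow> 'k"
  assumes finite_dimensional: "\<exists>B. finite_dimensional_vector_space scale B"
    and form_linear_left: "Vector_Spaces.linear scale (*) (\<lambda>v. form v w)"
    and form_linear_right: "Vector_Spaces.linear scale (*) (\<lambda>w. form v w)"
    and form_alternating: "form v v = 0"
begin

definition nullspace :: "'v set" where
  "nullspace = {v. \<forall>w. form v w = 0}"

definition has_type :: "nat \<Rightarrow> nat \<Rightarrow> bool" where
  "has_type n k \<longleftrightarrow> k = dim nullspace \<and> 2 * n + k = dim (UNIV :: 'v set)"

end

locale symplectic_root_system = symplectic_vector_space scale form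
  for G :: "'a pair_pre_digraph"
    and scale :: "bit \<Rightarrow> 'v::ab_group_add \<Rightarrow> 'v"
    and form :: "'v \<Rightarrow> 'v \<Rightarrow> bit"
    and f :: "'a \<Rightarrow> 'v" +
  assumes span_image: "span (f ` pverts G) = UNIV"
    and adjacent_iff:
      "\<alpha> \<in> pverts G \<Longrightarrow> \<beta> \<in> pverts G \<Longrightarrow> (\<alpha>, \<beta>) \<in> parcs G \<longleftrightarrow> form (f \<alpha>) (f \<beta>) \<noteq> 0"

end

theory Submission
  imports Defs
begin

text \<open>
  Let \<open>W\<close> be the span of the images of the nodes in \<open>\<Gamma>\<close>, and \<open>B\<close> the set of images of the other
  nodes. Since \<open>W\<close> is totally isotropic and \<open>W\<close> and \<open>B\<close> generate \<open>V\<close>, every vector of \<open>W\<close> that is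
  orthogonal to \<open>B\<close> lies in the nullspace. Orthogonality to \<open>B\<close> imposes at most \<open>card B\<close> linear
  conditions, so \<open>dim W \<le> k + card B\<close>, whence \<open>2 * n + k = dim V \<le> dim W + card B \<le> k + 2 * card B\<close>.
\<close>

text \<open>Subtracting the multiple of \<open>w\<close> with coefficient
  \<open>\<phi> v / \<phi> w\<close> moves any \<open>v\<close> of \<open>W\<close> into the kernel
  of \<open>\<phi>\<close> on \<open>W\<close>. So this kernel has codimension at most one in
  \<open>W\<close>.\<close>

lemma (in vector_space) span_subset_span_insert_kernel:
  assumes W: "subspace W" and \<phi>: "Vector_Spaces.linear scale (*) \<phi>"
    and w: "w \<in> W" "\<phi> w \<noteq> 0"
  shows "W \<subseteq> span (insert w {v \<in> W. \<phi> v = 0})"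
proof
  fix v assume v: "v \<in> W"
  interpret \<phi>: Vector_Spaces.linear scale "(*)" \<phi> by (fact \<phi>)
  let ?c = "\<phi> v / \<phi> w"
  have "v - ?c *s w \<in> W"
    using W v w by (simp add: subspace_diff subspace_scale)
  moreover have "\<phi> (v - ?c *s w) = 0"
    using w by (simp add: \<phi>.diff \<phi>.scale)
  ultimately show "v \<in> span (insert w {v \<in> W. \<phi> v = 0})"
    unfolding span_insert by (auto intro!: span_base)
qed

context finite_dimensional_vector_space
begin

lemma dim_le_Suc_dim_kernel:
  assumes "subspace W" and "Vector_Spaces.linear scale (*) \<phi>"
  shows "dim W \<le> Suc (dim {v \<in> W. \<phi> v = 0})"
proof (cases "\<exists>w\<in>W. \<phi> w \<noteq> 0")
  case True
  then obtain w where "w \<in> W" "\<phi> w \<noteq> 0" by blast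
  then have "dim W \<le> dim (insert w {v \<in> W. \<phi> v = 0})"
    by (intro dim_mono span_subset_span_insert_kernel assms)
  then show ?thesis
    by (simp add: dim_insert split: if_splits)
next
  case False
  then have "{v \<in> W. \<phi> v = 0} = W" by blast
  then show ?thesis by simp
qed

lemma dim_Un_le_dim_add_card:
  assumes "finite B"
  shows "dim (A \<union> B) \<le> dim A + card B"
  using assms
proof (induction B)
  case (insert b B)
  have "dim (A \<union> insert b B) \<le> Suc (dim (A \<union> B))"
    by (simp add: dim_insert)
  with insert show ?case by simp
qed simp

end

context symplectic_vector_space
begin

text \<open>The two arguments of the form are treated separately, in place of deriving symmetry from
  \<open>form_alternating\<close>. The set \<open>S\<close> serves both as a singleton and as the
  set of conditions imposed so far.\<close>

lemma subspace_left_orthogonal: "subspace {v. \<forall>s\<in>S. form v s = 0}"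
proof -
  have "form 0 s = 0" "form (x + y) s = form x s + form y s"
    "form (scale c x) s = c * form x s" for x y s c
  proof -
    interpret l: Vector_Spaces.linear scale "(*)" "\<lambda>v. form v s" by (fact form_linear_left)
    show "form 0 s = 0" "form (x + y) s = form x s + form y s"
      "form (scale c x) s = c * form x s"
      by (simp_all only: l.zero l.add l.scale)
  qed
  then show ?thesis by (auto simp: subspace_def)
qed

lemma subspace_right_orthogonal: "subspace {w. form v w = 0}"
proof -
  interpret r: Vector_Spaces.linear scale "(*)" "form v" by (fact form_linear_right)
  show ?thesis by (auto simp: subspace_def r.zero r.add r.scale)
qed

lemma form_span_right_eq_0:
  assumes "w \<in> span S" and "\<And>s. s \<in> S \<Longrightarrow> form v s = 0"
  shows "form v w = 0"
  using span_minimal[OF _ subspace_right_orthogonal, of S v] assms by blast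

lemma form_span_left_eq_0:
  assumes "v \<in> span S" and "\<And>s. s \<in> S \<Longrightarrow> form s w = 0"
  shows "form v w = 0"
  using span_minimal[OF _ subspace_left_orthogonal, of S "{w}"] assms by blast

text \<open>Each \<open>b\<close> adds one linear condition, the vanishing of the functional
  \<open>\<lambda>v. form v b\<close>, and so lowers the dimension by at most one.\<close>

lemma dim_le_dim_orthogonal_add_card:
  assumes "finite B" and W: "subspace W"
  shows "dim W \<le> dim {v \<in> W. \<forall>b\<in>B. form v b = 0} + card B"
  using assms(1)
proof (induction B)
  case (insert b B)
  obtain Basis where "finite_dimensional_vector_space scale Basis"
    using finite_dimensional by blast
  then interpret finite_dimensional_vector_space scale Basis .
  let ?K = "{v \<in> W. \<forall>b\<in>B. form v b = 0}"
  have "?K = W \<inter> {v. \<forall>b\<in>B. form v b = 0}" by blast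
  then have "subspace ?K"
    using W subspace_left_orthogonal by (simp add: subspace_inter)
  then have "dim ?K \<le> Suc (dim {v \<in> ?K. form v b = 0})"
    by (intro dim_le_Suc_dim_kernel form_linear_left)
  also have "{v \<in> ?K. form v b = 0} = {v \<in> W. \<forall>b\<in>insert b B. form v b = 0}"
    by blast
  finally show ?case using insert by simp
qed simp

lemma dim_le_dim_nullspace_add_card:
  assumes span: "span (A \<union> B) = UNIV" and B: "finite B"
    and isotropic: "\<And>x y. x \<in> A \<Longrightarrow> y \<in> A \<Longrightarrow> form x y = 0"
  shows "dim UNIV \<le> dim nullspace + 2 * card B"
proof -
  obtain Basis where "finite_dimensional_vector_space scale Basis"
    using finite_dimensional by blast
  then interpret finite_dimensional_vector_space scale Basis .
  let ?K = "{v \<in> span A. \<forall>b\<in>B. form v b = 0}"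
  \<comment> \<open>By isotropy \<open>v\<close> is orthogonal to \<open>A\<close>, as it lies in
    \<open>span A\<close>; by the choice of \<open>?K\<close> it is orthogonal to \<open>B\<close>.
    Together these generate the whole space.\<close>
  have "form v w = 0" if "v \<in> ?K" for v w
  proof (rule form_span_right_eq_0)
    show "w \<in> span (A \<union> B)" by (simp add: span)
    show "form v s = 0" if "s \<in> A \<union> B" for s
      using that \<open>v \<in> ?K\<close> isotropic form_span_left_eq_0[of v A s] by blast
  qed
  then have "?K \<subseteq> nullspace" by (auto simp: nullspace_def)
  then have "dim ?K \<le> dim nullspace" by (rule dim_subset)
  moreover have "dim A \<le> dim ?K + card B"
    using dim_le_dim_orthogonal_add_card[OF B subspace_span, of A] by simp
  moreover have "dim UNIV \<le> dim A + card B"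
    using dim_Un_le_dim_add_card[OF B, of A] dim_span[of "A \<union> B"] span by simp
  ultimately show ?thesis by simp
qed

end

theorem corollary4p4:
  fixes G :: "'a pair_pre_digraph"
    and \<Gamma> :: "'a set" and \<gamma> n k :: nat
    and scale :: "bit \<Rightarrow> 'v::ab_group_add \<Rightarrow> 'v"
    and form :: "'v \<Rightarrow> 'v \<Rightarrow> bit"
    and f :: "'a \<Rightarrow> 'v"
  assumes "pair_graph G"
    and "coclique G \<Gamma>" and "\<gamma> = card \<Gamma>" and "\<gamma> = coclique_number G"
    and "symplectic_root_system G scale form f"
    and "symplectic_vector_space.has_type scale form n k"
  shows "n \<le> card (pverts G - \<Gamma>) \<and> card (pverts G - \<Gamma>) = card (pverts G) - \<gamma>"
proof -
  interpret pair_graph G by (fact assms(1))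
  interpret symplectic_root_system G scale form f by (fact assms(5))
  have \<Gamma>: "\<Gamma> \<subseteq> pverts G" and nonadj: "\<And>\<alpha> \<beta>. \<alpha> \<in> \<Gamma> \<Longrightarrow> \<beta> \<in> \<Gamma> \<Longrightarrow> (\<alpha>, \<beta>) \<notin> parcs G"
    using assms(2) by (auto simp: coclique_def)
  let ?B = "f ` (pverts G - \<Gamma>)"
  have "f ` \<Gamma> \<union> ?B = f ` pverts G" using \<Gamma> by blast
  then have "span (f ` \<Gamma> \<union> ?B) = UNIV" by (simp add: span_image)
  moreover have "form x y = 0" if "x \<in> f ` \<Gamma>" "y \<in> f ` \<Gamma>" for x y
    using that \<Gamma> nonadj adjacent_iff by blast
  ultimately have "dim UNIV \<le> dim nullspace + 2 * card ?B"
    by (intro dim_le_dim_nullspace_add_card[of "f ` \<Gamma>"]) auto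
  \<comment> \<open>Only an inequality, because \<open>f\<close> may identify nodes.\<close>
  moreover have "card ?B \<le> card (pverts G - \<Gamma>)"
    by (simp add: card_image_le)
  \<comment> \<open>With \<open>2 * n + k = dim UNIV\<close> and \<open>k = dim nullspace\<close>,
    the summand \<open>k\<close> cancels and the factor 2 divides out.\<close>
  ultimately have "n \<le> card (pverts G - \<Gamma>)"
    using assms(6) by (simp add: has_type_def)
  \<comment> \<open>The subtraction on naturals does not truncate, since \<Gamma> lies in the finite
    set \<open>pverts G\<close>.\<close>
  moreover have "card (pverts G - \<Gamma>) = card (pverts G) - \<gamma>"
    using \<Gamma> assms(3) by (simp add: card_Diff_subset finite_subset[of _ "pverts G"])
  ultimately show ?thesis by blast
qed

end
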